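(* Let $\mathbf{V}$ be a valuation domain with field of fractions $\mathbf{K}$, let $u_1,\dots,u_n\in\mathbf{V}[X]^k$, and let $s^1,\dots,s^m\in\mathbf{K}[X]^n$ be generators of the syzygy module $\{f\in \mathbf{K}[X]^n \mid \sum_{j} f_j u_j=0\}$ of $(u_1,\dots,u_n)$ over $\mathbf{K}[X]$. One can suppose that the $s^j$ lie in $\mathbf{V}[X]^n$ (i.e. such generators can be chosen in $\mathbf{V}[X]^n$). When $s^1,\dots,s^m \in \mathbf{V}[X]^n$, the syzygy module $\{f\in \mathbf{V}[X]^n \mid \sum_j f_j u_j=0\}$ of $(u_1,\dots,u_n)$ over $\mathbf{V}[X]$ is equal to the $\mathbf{V}$-saturation in $\mathbf{V}[X]^n$ of the $\mathbf{V}[X]$-module generated by $s^1,\dots,s^m$. As a consequence, this syzygy module over $\mathbf{V}[X]$ is finitely generated. In particular, $\mathbf{V}[X]$ is a coherent ring.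
   Context: Rings are commutative with unit. A valuation domain is an integral domain $\mathbf{V}$ such that for all $a,b\in\mathbf{V}$ either $a\mid b$ or $b\mid a$. (Constructively, one assumes that this disjunction is decided by an algorithm which also produces the quotient, that equality to $0$ in $\mathbf{V}$ is decidable, and that $\mathbf{V}$ is residually discrete, i.e. one can decide whether an element is a unit; in classical mathematics these conditions hold for every valuation domain.) For a $\mathbf{V}$-submodule $M$ of a $\mathbf{V}$-module $N$, the $\mathbf{V}$-saturation of $M$ in $N$ is $\{x\in N\mid \exists a\in\mathbf{V}\setminus\{0\},\ ax\in M\}$. A ring is coherent if the syzygy module of every finitely generated ideal (i.e. of every finite family of elements of the ring) is finitely generated. *)

theory Defs
  imports
    "HOL-Computational_Algebra.Polynomial_Factorial"
    "HOL-Library.Function_Algebras"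
begin

class valuation_domain = idom +
  assumes dvd_total: "a dvd b \<or> b dvd a"

text \<open>
  The free module \<open>R\<^sup>n\<close> is the set of functions \<open>nat \<Rightarrow> R\<close> vanishing outside \<open>{..<n}\<close>, with
  pointwise operations; so coordinates and families are indexed from \<open>0\<close>. All \<open>R\<^sup>n\<close> are thus
  submodules of one ambient \<open>R\<close>-module, and generated submodules are given by the library's
  \<^const>\<open>module.span\<close>.
\<close>

definition free_module :: "nat \<Rightarrow> (nat \<Rightarrow> 'r::zero) set" where
  "free_module n = {f. \<forall>i\<ge>n. f i = 0}"

definition vscale :: "'r::comm_ring_1 \<Rightarrow> (nat \<Rightarrow> 'r) \<Rightarrow> nat \<Rightarrow> 'r" where
  "vscale c f = (\<lambda>i. c * f i)"

interpretation vec: module vscale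
  by unfold_locales (auto simp: vscale_def fun_eq_iff algebra_simps)

text \<open>
  The parameter \<open>scale\<close> is the module structure the \<open>u j\<close> live in: \<^const>\<open>vscale\<close> for vectors,
  multiplication for elements of the ring itself.
\<close>

definition syzygies ::
    "('r::comm_ring_1 \<Rightarrow> 'm::ab_group_add \<Rightarrow> 'm) \<Rightarrow> nat \<Rightarrow> (nat \<Rightarrow> 'm) \<Rightarrow> (nat \<Rightarrow> 'r) set" where
  "syzygies scale n u = {f \<in> free_module n. (\<Sum>j<n. scale (f j) (u j)) = 0}"

definition finitely_generated :: "(nat \<Rightarrow> 'r::comm_ring_1) set \<Rightarrow> bool" where
  "finitely_generated M \<longleftrightarrow> (\<exists>S. finite S \<and> vec.span S = M)"

definition coherent_ring :: "'r::comm_ring_1 itself \<Rightarrow> bool" where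
  "coherent_ring _ \<longleftrightarrow> (\<forall>n (a :: nat \<Rightarrow> 'r). finitely_generated (syzygies (*) n a))"

definition saturation ::
    "('v::zero \<Rightarrow> 'm \<Rightarrow> 'm) \<Rightarrow> 'm set \<Rightarrow> 'm set \<Rightarrow> 'm set" where
  "saturation scale M N = {x \<in> N. \<exists>a. a \<noteq> 0 \<and> scale a x \<in> M}"

text \<open>The action of \<open>V\<close> on vectors over \<open>V[X]\<close>.\<close>

definition const_scale :: "'v::comm_ring_1 \<Rightarrow> (nat \<Rightarrow> 'v poly) \<Rightarrow> nat \<Rightarrow> 'v poly" where
  "const_scale a f = (\<lambda>i. smult a (f i))"

text \<open>The inclusion of vectors over \<open>V[X]\<close> into vectors over \<open>K[X]\<close>, with \<open>K\<close> the type
  \<^typ>\<open>'v fract\<close>.\<close>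

definition fract_vec :: "(nat \<Rightarrow> 'v::idom poly) \<Rightarrow> nat \<Rightarrow> 'v fract poly" where
  "fract_vec f = (\<lambda>i. fract_poly (f i))"

end

theory Submission imports Defs begin

text \<open>
  Everything rests on the fact that a \<open>V\<close>-saturated submodule \<open>M\<close> of \<open>V[X]\<^sup>n\<close> is finitely
  generated; all syzygy modules over \<open>V[X]\<close> are saturated. Say that \<open>f\<close> leads at the monomial
  \<open>X\<^sup>a e\<^sub>i\<close> if its coefficient there is a unit and all later coefficients lie in the maximal
  ideal. The pairs \<open>(a, b)\<close> such that some \<open>f \<in> M\<close> of degree at most \<open>a + b\<close> leads at
  \<open>X\<^sup>a e\<^sub>i\<close> are closed under increasing \<open>a\<close> (multiply by \<open>X\<close>) and \<open>b\<close>, hence have finitely many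
  minimal elements (Dickson), and the corresponding \<open>f\<close> generate a submodule \<open>N \<subseteq> M\<close>.
  For every degree bound \<open>d\<close>, \<open>M\<close> and \<open>N\<close> have the same leading monomials in degree at most \<open>d\<close>.
  Given \<open>f \<in> M\<close>, elimination with elements of \<open>N\<close> makes the coefficients at all of them vanish;
  a non-zero remainder, divided by a coefficient that divides all others, would
  by saturation be an element of \<open>M\<close> leading at a monomial where its coefficient is zero.
\<close>

section \<open>Divisibility in valuation domains and Dickson's lemma for pairs\<close>

text \<open>One of \<open>x\<close>, \<open>y\<close> divides the other and hence the sum, so it
  would divide 1 as well. This makes the nonunits the maximal ideal.\<close>

lemma nonunit_add:
  fixes x y :: "'v::valuation_domain"
  assumes "\<not> x dvd 1" "\<not> y dvd 1"
  shows "\<not> (x + y) dvd 1"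
proof
  assume u: "(x + y) dvd 1"
  consider "x dvd y" | "y dvd x" using dvd_total by blast
  then show False
  proof cases
    case 1
    then have "x dvd x + y" by simp
    then show False using u assms(1) dvd_trans by blast
  next
    case 2
    then have "y dvd x + y" by simp
    then show False using u assms(2) dvd_trans by blast
  qed
qed

lemma nonunit_diff:
  fixes x y :: "'v::valuation_domain"
  assumes "\<not> x dvd 1" "\<not> y dvd 1"
  shows "\<not> (x - y) dvd 1"
  using nonunit_add[of x "- y"] assms by simp

lemma finite_least_divisor:
  fixes f :: "'i \<Rightarrow> 'v::valuation_domain"
  assumes "finite I" "I \<noteq> {}"
  shows "\<exists>i\<in>I. \<forall>j\<in>I. f i dvd f j"
  using assms
proof (induction rule: finite_ne_induct)
  case (singleton x)
  then show ?case by simp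
next
  case (insert x F)
  then obtain i where "i \<in> F" "\<forall>j\<in>F. f i dvd f j" by blast
  then show ?case using dvd_total[of "f i" "f x"] by (metis dvd_refl dvd_trans insert_iff)
qed

text \<open>Fix one pair \<open>(a0, b0)\<close> of \<open>A\<close>. A pair not above it lies in
  one of finitely many columns \<open>a < a0\<close> or rows \<open>b < b0\<close>, and each of
  these contributes its lowest element.\<close>

lemma finite_minimal_pairs:
  fixes A :: "(nat \<times> nat) set"
  shows "\<exists>D\<subseteq>A. finite D \<and> (\<forall>(a, b)\<in>A. \<exists>(a', b')\<in>D. a' \<le> a \<and> b' \<le> b)"
proof (cases "A = {}")
  case True
  then show ?thesis by blast
next
  case False
  then obtain a0 b0 where 0: "(a0, b0) \<in> A" by auto
  let ?L = "(\<lambda>a. (a, LEAST b. (a, b) \<in> A)) ` {a. a < a0 \<and> (\<exists>b. (a, b) \<in> A)}"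
  let ?R = "(\<lambda>b. (LEAST a. (a, b) \<in> A, b)) ` {b. b < b0 \<and> (\<exists>a. (a, b) \<in> A)}"
  let ?D = "insert (a0, b0) (?L \<union> ?R)"
  have "?D \<subseteq> A" using 0 by (auto intro: LeastI)
  moreover have "finite ?D" by simp
  moreover have "\<exists>(a', b')\<in>?D. a' \<le> a \<and> b' \<le> b" if ab: "(a, b) \<in> A" for a b
  proof -
    consider "a < a0" | "b < b0" | "a0 \<le> a" "b0 \<le> b" by linarith
    then show ?thesis
    proof cases
      case 1
      then have "(a, LEAST b. (a, b) \<in> A) \<in> ?D" using ab by blast
      moreover have "(LEAST b. (a, b) \<in> A) \<le> b" using ab by (rule Least_le)
      ultimately show ?thesis by blast
    next
      case 2
      then have "(LEAST a. (a, b) \<in> A, b) \<in> ?D" using ab by blast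
      moreover have "(LEAST a. (a, b) \<in> A) \<le> a" using ab by (rule Least_le)
      ultimately show ?thesis by blast
    next
      case 3
      then show ?thesis by blast
    qed
  qed
  ultimately show ?thesis by (intro exI[of _ ?D]) blast
qed

section \<open>Leading positions and elimination modulo the maximal ideal\<close>

definition leads :: "(nat \<Rightarrow> 'v::valuation_domain) \<Rightarrow> nat \<Rightarrow> bool" where
  "leads f p \<longleftrightarrow> f p dvd 1 \<and> (\<forall>q>p. \<not> f q dvd 1)"

text \<open>
  Modulo the maximal ideal the elements of \<open>T\<close> leading at the positions in \<open>P\<close> form a triangular
  system, so it can be solved; requiring \<open>g\<close> to be non-invertible beyond \<open>B\<close> keeps the pivot of
  the next step invertible.
\<close>
lemma interpolate_at_leading_positions:
  fixes T :: "(nat \<Rightarrow> 'v::valuation_domain) set"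
  assumes T: "vec.subspace T" and P: "\<And>p. p \<in> P \<Longrightarrow> \<exists>e\<in>T. leads e p"
  shows "\<exists>g\<in>T. (\<forall>p\<in>P. p < B \<longrightarrow> g p = f p) \<and> (\<forall>q\<ge>B. \<not> g q dvd 1)"
proof (induction B arbitrary: f)
  case 0
  show ?case by (rule bexI[of _ 0]) (auto simp: vec.subspace_0[OF T])
next
  case (Suc B)
  obtain g where g: "g \<in> T" "\<And>p. p \<in> P \<Longrightarrow> p < B \<Longrightarrow> g p = f p" "\<And>q. q \<ge> B \<Longrightarrow> \<not> g q dvd 1"
    using Suc[of f] by blast
  show ?case
  proof (cases "B \<in> P")
    case False
    then have "\<forall>p\<in>P. p < Suc B \<longrightarrow> g p = f p" using g(2) less_Suc_eq by metis
    then show ?thesis using g by (meson Suc_leD)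
  next
    case True
    then obtain e where e: "e \<in> T" "e B dvd 1" "\<And>q. q > B \<Longrightarrow> \<not> e q dvd 1"
      using P unfolding leads_def by blast
    \<comment> \<open>The induction hypothesis, now for \<open>e\<close> in place of
      \<open>f\<close>: subtracting \<open>e'\<close> clears the earlier positions of
      \<open>P\<close> and keeps the entry at \<open>B\<close> a unit.\<close>
    obtain e' where e': "e' \<in> T" "\<And>p. p \<in> P \<Longrightarrow> p < B \<Longrightarrow> e' p = e p"
        "\<And>q. q \<ge> B \<Longrightarrow> \<not> e' q dvd 1"
      using Suc[of e] by blast
    define d where "d = e - e'"
    have dB: "d B dvd 1"
      using nonunit_add[of "d B" "e' B"] e(2) e'(3)[of B] unfolding d_def by auto
    then obtain w where w: "d B * w = 1" by (metis dvdE)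
    \<comment> \<open>Chosen so that adding \<open>c\<close> times \<open>d\<close> corrects the
      entry of \<open>g\<close> at \<open>B\<close> to \<open>f B\<close>; the earlier positions of
      \<open>P\<close> stay as they are.\<close>
    define c where "c = w * (f B - g B)"
    define g' where "g' = g + vscale c d"
    have "g' \<in> T" unfolding g'_def d_def
      by (intro vec.subspace_add[OF T] vec.subspace_scale[OF T] vec.subspace_diff[OF T] g e e')
    moreover have "g' p = f p" if "p \<in> P" "p < Suc B" for p
    proof (cases "p = B")
      case True
      have "c * d B = (d B * w) * (f B - g B)" by (simp add: c_def mult.commute mult.left_commute)
      then show ?thesis using True w by (simp add: g'_def vscale_def)
    next
      case False
      then show ?thesis using that g(2) e'(2) by (simp add: g'_def vscale_def d_def)
    qed
    moreover have "\<not> g' q dvd 1" if "q \<ge> Suc B" for q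
    proof -
      have "\<not> d q dvd 1" using nonunit_diff e(3)[of q] e'(3)[of q] that by (simp add: d_def)
      then have "\<not> (c * d q) dvd 1" by (metis dvd_trans dvd_triv_right)
      then show ?thesis using nonunit_add g(3)[of q] that by (simp add: g'_def vscale_def)
    qed
    ultimately show ?thesis by blast
  qed
qed

text \<open>The common bound \<open>B\<close> leaves finitely many positions to clear and to compare
  by divisibility. It is why the lemma is later applied to degree-bounded parts of a module.\<close>

lemma subset_if_same_leading_positions:
  fixes S T :: "(nat \<Rightarrow> 'v::valuation_domain) set"
  assumes S: "vec.subspace S" and T: "vec.subspace T" and "T \<subseteq> S"
    and bounded: "\<And>f q. f \<in> S \<Longrightarrow> q \<ge> B \<Longrightarrow> f q = 0"
    and sat: "\<And>f c. f \<in> S \<Longrightarrow> c \<noteq> 0 \<Longrightarrow> \<forall>p. c dvd f p \<Longrightarrow> \<exists>g\<in>S. f = vscale c g"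
    and lead: "\<And>f p. f \<in> S \<Longrightarrow> leads f p \<Longrightarrow> \<exists>e\<in>T. leads e p"
  shows "S \<subseteq> T"
proof
  fix f assume f: "f \<in> S"
  have "\<exists>g\<in>T. (\<forall>p\<in>{p. \<exists>e\<in>S. leads e p}. p < B \<longrightarrow> g p = f p) \<and> (\<forall>q\<ge>B. \<not> g q dvd 1)"
    by (rule interpolate_at_leading_positions[OF T]) (use lead in blast)
  then obtain g where g: "g \<in> T" "\<And>p. p < B \<Longrightarrow> \<exists>e\<in>S. leads e p \<Longrightarrow> g p = f p" by auto
  define h where "h = f - g"
  have h: "h \<in> S" unfolding h_def using vec.subspace_diff[OF S] f g(1) \<open>T \<subseteq> S\<close> by blast
  have "h = 0"
  proof (rule ccontr)
    assume "h \<noteq> 0"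
    then obtain q where q: "h q \<noteq> 0" by (auto simp: fun_eq_iff)
    then have "q < B" using bounded[OF h] not_le by blast
    then obtain p where p: "p < B" "\<And>j. j < B \<Longrightarrow> h p dvd h j"
      using finite_least_divisor[of "{..<B}" h] by auto
    have p0: "h p \<noteq> 0" using p(2)[OF \<open>q < B\<close>] q by auto
    have "\<forall>j. h p dvd h j" using p(2) bounded[OF h] by (metis dvd_0_right not_le)
    then obtain k where k: "k \<in> S" "h = vscale (h p) k" using sat[OF h p0] by blast
    have "h p * k p = h p * 1" using fun_cong[OF k(2), of p] by (simp add: vscale_def)
    then have "k p = 1" using p0 by (simp only: mult_cancel_left) simp
    \<comment> \<open>The last unit entry of \<open>k\<close>: one exists since
      \<open>k p = 1\<close>, and there is a last one since \<open>k\<close> vanishes from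
      \<open>B\<close> on.\<close>
    define r where "r = (GREATEST j. k j dvd 1)"
    have kB: "j \<le> B" if "k j dvd 1" for j using that bounded[OF k(1), of j] by fastforce
    have r: "k r dvd 1" unfolding r_def
      by (rule GreatestI_nat[where b = B and k = p]) (use \<open>k p = 1\<close> kB in auto)
    have "\<not> k j dvd 1" if "j > r" for j
      using that Greatest_le_nat[of "\<lambda>j. k j dvd 1" j B] kB r_def by fastforce
    then have "leads k r" using r by (simp add: leads_def)
    moreover have "r < B" using r bounded[OF k(1), of r] by (metis not_le dvd_0_left zero_neq_one)
    \<comment> \<open>The position \<open>r\<close> is among those cleared by \<open>g\<close>,
      although \<open>h r = h p * k r\<close> is a product of nonzero factors.\<close>
    ultimately have "g r = f r" using g(2) k(1) by blast
    then have "h r = 0" by (simp add: h_def)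
    then have "k r = 0" using p0 fun_cong[OF k(2), of r] by (simp add: vscale_def)
    then show False using r by simp
  qed
  then show "f \<in> T" using g(1) by (simp add: h_def)
qed

section \<open>Coefficient sequences of polynomial vectors\<close>

text \<open>
  The coefficients of a vector of polynomials listed in a single sequence: the coefficient of
  \<open>X\<^sup>a\<close> in component \<open>i < n\<close> sits at position \<open>a * n + i\<close>, so multiplication by \<open>X\<close> is a
  shift by \<open>n\<close>.
\<close>
definition coeff_seq :: "nat \<Rightarrow> (nat \<Rightarrow> 'a::zero poly) \<Rightarrow> nat \<Rightarrow> 'a" where
  "coeff_seq n f p = coeff (f (p mod n)) (p div n)"

lemma coeff_seq_add:
  fixes f g :: "nat \<Rightarrow> 'a::comm_ring_1 poly"
  shows "coeff_seq n (f + g) = coeff_seq n f + coeff_seq n g"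
  by (simp add: coeff_seq_def fun_eq_iff)

lemma coeff_seq_scale: "coeff_seq n (vscale [:c:] f) = vscale c (coeff_seq n f)"
  by (simp add: coeff_seq_def fun_eq_iff vscale_def)

lemma coeff_seq_zero: "coeff_seq n 0 = 0"
  by (simp add: coeff_seq_def fun_eq_iff)

lemma coeff_seq_shift:
  fixes f :: "nat \<Rightarrow> 'a::comm_ring_1 poly"
  assumes "n > 0"
  shows "coeff_seq n (vscale (monom 1 k) f) (k * n + p) = coeff_seq n f p"
  using assms by (simp add: coeff_seq_def vscale_def coeff_monom_mult)

lemma coeff_seq_at:
  assumes "i < n"
  shows "coeff_seq n f (a * n + i) = coeff (f i) a"
  using assms by (simp add: coeff_seq_def)

lemma coeff_seq_inj:
  assumes "f \<in> free_module n" "g \<in> free_module n" "coeff_seq n f = coeff_seq n g"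
  shows "f = g"
proof
  fix i
  show "f i = g i"
  proof (cases "i < n")
    case True
    then show ?thesis using assms(3) coeff_seq_at[OF True] by (metis poly_eqI)
  next
    case False
    then show ?thesis using assms by (simp add: free_module_def)
  qed
qed

text \<open>Multiplication by constants respects the degree bound, multiplication by
  \<open>X\<close> does not: what remains is a module over the coefficient ring.\<close>

lemma subspace_coeff_seq:
  fixes M :: "(nat \<Rightarrow> 'a::comm_ring_1 poly) set"
  assumes "vec.subspace M"
  shows "vec.subspace (coeff_seq n ` {f \<in> M. \<forall>j. degree (f j) \<le> d})"
proof (rule vec.subspaceI)
  let ?M = "{f \<in> M. \<forall>j. degree (f j) \<le> d}"
  show "0 \<in> coeff_seq n ` ?M"
    by (rule image_eqI[of _ _ 0]) (auto simp: coeff_seq_zero vec.subspace_0[OF assms])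
  fix x assume "x \<in> coeff_seq n ` ?M"
  then obtain f where f: "x = coeff_seq n f" "f \<in> M" "\<And>j. degree (f j) \<le> d" by blast
  {
    fix y assume "y \<in> coeff_seq n ` ?M"
    then obtain g where g: "y = coeff_seq n g" "g \<in> M" "\<And>j. degree (g j) \<le> d" by blast
    show "x + y \<in> coeff_seq n ` ?M"
      by (rule image_eqI[of _ _ "f + g"])
        (use f g vec.subspace_add[OF assms] in \<open>auto simp: coeff_seq_add intro: degree_add_le\<close>)
  }
  fix c :: 'a
  have "vscale [:c:] f \<in> M" using f(2) by (rule vec.subspace_scale[OF assms])
  moreover have "degree (vscale [:c:] f j) \<le> d" for j
    using f(3)[of j] degree_smult_le[of c "f j"] by (simp add: vscale_def)
  ultimately show "vscale c x \<in> coeff_seq n ` ?M"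
    by (intro image_eqI[of _ _ "vscale [:c:] f"]) (auto simp: coeff_seq_scale f(1))
qed

section \<open>Finite generation of saturated submodules\<close>

theorem saturated_submodule_finitely_generated:
  fixes M :: "(nat \<Rightarrow> 'v::valuation_domain poly) set"
  assumes M: "vec.subspace M" and free: "M \<subseteq> free_module n"
    and sat: "\<And>f c. f \<in> free_module n \<Longrightarrow> c \<noteq> 0 \<Longrightarrow> const_scale c f \<in> M \<Longrightarrow> f \<in> M"
  shows "finitely_generated M"
proof (cases "n = 0")
  case True
  then have "M = {0}"
    using free vec.subspace_0[OF M] by (auto simp: free_module_def fun_eq_iff)
  then have "vec.span {} = M" by simp
  then show ?thesis unfolding finitely_generated_def by blast
next
  case False
  then have n: "n > 0" by simp
  \<comment> \<open>The true degree may exceed the exponent \<open>a\<close> of the leading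
    monomial, and \<open>b\<close> bounds the excess. Multiplication by \<open>X\<close> raises
    \<open>a\<close> and the degree bound together and leaves \<open>b\<close> alone.\<close>
  define A where "A = (\<lambda>i. {(a, b). \<exists>f\<in>M. (\<forall>j. degree (f j) \<le> a + b) \<and>
    leads (coeff_seq n f) (a * n + i)})"
  have "\<forall>i. \<exists>D. D \<subseteq> A i \<and> finite D \<and>
      (\<forall>(a, b)\<in>A i. \<exists>(a', b')\<in>D. a' \<le> a \<and> b' \<le> b)"
    using finite_minimal_pairs by simp
  from choice[OF this] obtain D where D: "\<forall>i. D i \<subseteq> A i \<and> finite (D i) \<and>
      (\<forall>(a, b)\<in>A i. \<exists>(a', b')\<in>D i. a' \<le> a \<and> b' \<le> b)" ..
  have DA: "D i \<subseteq> A i" and Dfin: "finite (D i)" for i using D by simp_all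
  have Dmin: "\<exists>a' b'. (a', b') \<in> D i \<and> a' \<le> a \<and> b' \<le> b" if "(a, b) \<in> A i" for i a b
    using bspec[of "A i" _ "(a, b)"] D that by fast
  have "\<forall>i a b. \<exists>f. (a, b) \<in> A i \<longrightarrow> f \<in> M \<and> (\<forall>j. degree (f j) \<le> a + b) \<and>
      leads (coeff_seq n f) (a * n + i)"
    unfolding A_def by blast
  then obtain w where w: "\<And>i a b. (a, b) \<in> A i \<Longrightarrow> w i a b \<in> M \<and>
      (\<forall>j. degree (w i a b j) \<le> a + b) \<and> leads (coeff_seq n (w i a b)) (a * n + i)"
    by metis
  define G where "G = (\<Union>i<n. (\<lambda>(a, b). w i a b) ` D i)"
  have "finite G" unfolding G_def using Dfin by blast
  have "G \<subseteq> M" unfolding G_def using DA w by fastforce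
  then have GM: "vec.span G \<subseteq> M" using vec.span_minimal M by blast
  have "f \<in> vec.span G" if f: "f \<in> M" for f
  proof -
    define d where "d = Max ((\<lambda>j. degree (f j)) ` {..n})"
    have d: "degree (f j) \<le> d" for j
    proof (cases "j \<le> n")
      case True
      then show ?thesis unfolding d_def by (intro Max_ge) auto
    next
      case False
      then show ?thesis using f free by (auto simp: free_module_def)
    qed
    define S where "S = coeff_seq n ` {f \<in> M. \<forall>j. degree (f j) \<le> d}"
    define T where "T = coeff_seq n ` {f \<in> vec.span G. \<forall>j. degree (f j) \<le> d}"
    have "S \<subseteq> T"
    proof (rule subset_if_same_leading_positions)
      show "vec.subspace S" unfolding S_def by (rule subspace_coeff_seq[OF M])
      show "vec.subspace T" unfolding T_def by (intro subspace_coeff_seq vec.subspace_span)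
      show "T \<subseteq> S" unfolding S_def T_def using GM by blast
    next
      fix x q assume "x \<in> S" and q: "q \<ge> Suc d * n"
      then obtain f where f: "x = coeff_seq n f" "\<And>j. degree (f j) \<le> d" unfolding S_def by blast
      \<comment> \<open>The positions from \<open>Suc d * n\<close> on belong to powers of
        \<open>X\<close> above \<open>d\<close>.\<close>
      have "d < q div n" using q n by (metis Suc_le_eq less_eq_div_iff_mult_less_eq)
      then show "x q = 0" unfolding f coeff_seq_def using f(2)
        by (meson coeff_eq_0 le_less_trans)
    next
      fix x and c :: 'v assume "x \<in> S" and c: "c \<noteq> 0" "\<forall>p. c dvd x p"
      then obtain f where f: "x = coeff_seq n f" "f \<in> M" "\<And>j. degree (f j) \<le> d"
        unfolding S_def by blast
      \<comment> \<open>Divisibility of all entries by \<open>c\<close> becomes division of each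
        component by \<open>c\<close>; saturation then puts the quotient into
        \<open>M\<close>.\<close>
      have "\<exists>g. f j = smult c g" for j
      proof (cases "j < n")
        case True
        have "\<forall>a. c dvd coeff (f j) a" using c(2) f(1) coeff_seq_at[OF True] by metis
        then have "[:c:] dvd f j" by (simp add: const_poly_dvd_iff)
        then show ?thesis by (auto simp: dvd_def)
      next
        case False
        then have "f j = smult c 0" using f(2) free by (auto simp: free_module_def)
        then show ?thesis by blast
      qed
      then obtain g where g: "\<And>j. f j = smult c (g j)" by metis
      have fg: "f = const_scale c g" using g by (auto simp: const_scale_def)
      have "g \<in> free_module n" using f(2) free g c(1) by (fastforce simp: free_module_def)
      then have "g \<in> M" using sat c(1) f(2) fg by blast
      moreover have "degree (g j) \<le> d" for j using f(3)[of j] g[of j] c(1) by simp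
      ultimately have "coeff_seq n g \<in> S" unfolding S_def by blast
      moreover have "x = vscale c (coeff_seq n g)"
        by (auto simp: f(1) fg const_scale_def vscale_def coeff_seq_def)
      ultimately show "\<exists>g\<in>S. x = vscale c g" by blast
    next
      fix x p assume "x \<in> S" and p: "leads x p"
      then obtain f where f: "x = coeff_seq n f" "f \<in> M" "\<And>j. degree (f j) \<le> d"
        unfolding S_def by blast
      define a i where "a = p div n" and "i = p mod n"
      have pai: "p = a * n + i" and i: "i < n" using n by (auto simp: a_def i_def)
      have "coeff (f i) a \<noteq> 0" using p unfolding leads_def f(1) pai coeff_seq_at[OF i] by auto
      then have "a \<le> d" using f(3)[of i] le_degree order_trans by blast
      \<comment> \<open>As \<open>a \<le> d\<close>, the subtraction is exact and the degree bound
        \<open>a + (d - a)\<close> is \<open>d\<close>.\<close>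
      then have "(a, d - a) \<in> A i" unfolding A_def using f p pai by auto
      then obtain a' b' where D': "(a', b') \<in> D i" "a' \<le> a" "b' \<le> d - a" using Dmin by blast
      \<comment> \<open>Multiplying the generator by the \<open>k\<close>-th power of
        \<open>X\<close> moves its leading exponent from \<open>a'\<close> to \<open>a\<close>; the
        degree stays at most \<open>a + b'\<close>, hence at most \<open>d\<close>.\<close>
      define k where "k = a - a'"
      have ak: "a = k + a'" using D'(2) by (simp add: k_def)
      let ?w = "w i a' b'"
      have W: "\<And>j. degree (?w j) \<le> a' + b'" "leads (coeff_seq n ?w) (a' * n + i)"
        using w DA D'(1) by blast+
      define e where "e = vscale (monom 1 k) ?w"
      have "?w \<in> G" unfolding G_def using i D'(1) by blast
      then have "e \<in> vec.span G" unfolding e_def by (intro vec.span_scale vec.span_base)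
      moreover have "degree (e j) \<le> d" for j
      proof -
        have "degree (e j) \<le> k + degree (?w j)" unfolding e_def vscale_def
          by (rule order_trans[OF degree_mult_le]) (simp add: degree_monom_eq)
        then show ?thesis using W(1)[of j] D' \<open>a \<le> d\<close> ak by linarith
      qed
      moreover have "leads (coeff_seq n e) p"
      proof -
        have p': "p = k * n + (a' * n + i)" using pai ak by (simp add: algebra_simps)
        have "\<not> coeff_seq n e q dvd 1" if "q > p" for q
        proof -
          define r where "r = q - k * n"
          have r: "q = k * n + r" "r > a' * n + i" using that p' unfolding r_def by linarith+
          then show ?thesis using W(2) by (simp add: leads_def e_def coeff_seq_shift[OF n])
        qed
        moreover have "coeff_seq n e p dvd 1"
          using W(2) by (simp add: p' leads_def e_def coeff_seq_shift[OF n])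
        ultimately show ?thesis by (simp add: leads_def)
      qed
      ultimately show "\<exists>e\<in>T. leads e p" unfolding T_def by blast
    qed
    moreover have "coeff_seq n f \<in> S" unfolding S_def using f d by blast
    ultimately obtain g where "g \<in> vec.span G" "coeff_seq n f = coeff_seq n g"
      unfolding T_def by blast
    then show ?thesis using coeff_seq_inj f free GM by (metis subsetD)
  qed
  then have "vec.span G = M" using GM by blast
  then show ?thesis unfolding finitely_generated_def using \<open>finite G\<close> by blast
qed

section \<open>Syzygy modules are saturated\<close>

lemma const_scale_eq: "const_scale c f = vscale [:c:] f"
  by (simp add: const_scale_def vscale_def)

lemma subspace_syzygies:
  fixes u :: "nat \<Rightarrow> 'm::ab_group_add"
  assumes "module scale"
  shows "vec.subspace (syzygies scale n u)"
proof -
  interpret m: module scale by fact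
  show ?thesis
    by (rule vec.subspaceI)
      (auto simp: syzygies_def free_module_def vscale_def m.scale_left_distrib sum.distrib
        simp flip: m.scale_scale m.scale_sum_right)
qed

text \<open>The constant factors out of the relation and cancels, the target having no
  \<open>c\<close>-torsion.\<close>

lemma syzygies_saturated:
  fixes scale :: "'r::comm_ring_1 poly \<Rightarrow> 'm::ab_group_add \<Rightarrow> 'm"
  assumes "module scale" and torsion_free: "\<And>x. scale [:c:] x = 0 \<Longrightarrow> x = 0"
    and f: "f \<in> free_module n" "const_scale c f \<in> syzygies scale n u"
  shows "f \<in> syzygies scale n u"
proof -
  interpret m: module scale by fact
  have "scale [:c:] (\<Sum>j<n. scale (f j) (u j)) = 0"
    using f(2) by (simp add: syzygies_def const_scale_eq vscale_def m.scale_sum_right m.scale_scale)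
  then show ?thesis using torsion_free f(1) by (simp add: syzygies_def)
qed

text \<open>The action \<open>scale\<close> is kept general to cover both vectors and, for
  coherence, the ring itself.\<close>

lemma syzygies_finitely_generated:
  fixes scale :: "'v::valuation_domain poly \<Rightarrow> 'm::ab_group_add \<Rightarrow> 'm"
  assumes "module scale" and "\<And>c x. c \<noteq> 0 \<Longrightarrow> scale [:c:] x = 0 \<Longrightarrow> x = 0"
  shows "finitely_generated (syzygies scale n u)"
proof (rule saturated_submodule_finitely_generated)
  show "vec.subspace (syzygies scale n u)" by (rule subspace_syzygies) fact
  show "syzygies scale n u \<subseteq> free_module n" by (auto simp: syzygies_def)
  show "f \<in> syzygies scale n u"
    if "f \<in> free_module n" "c \<noteq> 0" "const_scale c f \<in> syzygies scale n u" for f c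
    using syzygies_saturated[of scale c] assms that by blast
qed

lemma module_mult: "module ((*) :: 'r::comm_ring_1 \<Rightarrow> 'r \<Rightarrow> 'r)"
  by unfold_locales (auto simp: algebra_simps)

lemma vscale_torsion_free:
  fixes c :: "'r::idom"
  assumes "c \<noteq> 0" "vscale [:c:] x = 0"
  shows "x = 0"
  using assms by (auto simp: vscale_def fun_eq_iff)

section \<open>Passage to the fraction field and clearing of denominators\<close>

lemma fract_vec_add: "fract_vec (f + g) = fract_vec f + fract_vec g"
  by (simp add: fract_vec_def fun_eq_iff)

lemma fract_vec_vscale: "fract_vec (vscale c f) = vscale (fract_poly c) (fract_vec f)"
  by (simp add: fract_vec_def vscale_def fun_eq_iff)

lemma fract_vec_zero: "fract_vec 0 = 0"
  by (simp add: fract_vec_def fun_eq_iff)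

(* The goals of the induction are eta-expanded, so the deleted rules would rewrite under the binder. *)
lemma fract_vec_sum: "fract_vec (sum f A) = (\<Sum>a\<in>A. fract_vec (f a))"
  by (induction A rule: infinite_finite_induct) (simp_all add: fract_vec_zero fract_vec_add del: zero_fun_apply plus_fun_apply)

lemma fract_vec_eq_iff: "fract_vec f = fract_vec g \<longleftrightarrow> f = g"
  by (simp add: fract_vec_def fun_eq_iff)

lemma fract_vec_free_module_iff: "fract_vec f \<in> free_module n \<longleftrightarrow> f \<in> free_module n"
  by (simp add: fract_vec_def free_module_def)

lemma fract_vec_syzygies_iff:
  "fract_vec f \<in> syzygies vscale n (\<lambda>j. fract_vec (u j)) \<longleftrightarrow> f \<in> syzygies vscale n u"
proof -
  have "(\<Sum>j<n. vscale (fract_vec f j) (fract_vec (u j))) = fract_vec (\<Sum>j<n. vscale (f j) (u j))"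
    by (simp add: fract_vec_sum fract_vec_vscale) (simp add: fract_vec_def)
  then show ?thesis
    by (simp add: syzygies_def fract_vec_free_module_iff fract_vec_eq_iff flip: fract_vec_zero)
qed

lemma clear_denominators_poly:
  fixes p :: "'a::idom fract poly"
  shows "\<exists>b q. b \<noteq> 0 \<and> smult (to_fract b) p = fract_poly q"
proof (induction p)
  case 0
  show ?case by (intro exI[of _ 1] exI[of _ 0]) simp
next
  case (pCons a p)
  then obtain b q where b: "b \<noteq> 0" "smult (to_fract b) p = fract_poly q" by blast
  obtain x y where y: "a = Fract x y" "y \<noteq> 0" by (cases a) auto
  have "to_fract y * a = to_fract x" using y by (simp add: Fract_conv_to_fract)
  then have "to_fract (b * y) * a = to_fract (b * x)" by (simp add: mult.assoc)
  moreover have "smult (to_fract (b * y)) p = fract_poly (smult y q)"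
    by (simp add: b(2)[symmetric] mult.commute)
  ultimately have "smult (to_fract (b * y)) (pCons a p) = fract_poly (pCons (b * x) (smult y q))"
    by (simp add: map_poly_pCons del: to_fract_mult fract_poly_smult)
  then show ?case using b y by (intro exI[of _ "b * y"]) auto
qed

lemma clear_denominators_vec:
  fixes f :: "nat \<Rightarrow> 'a::idom fract poly"
  assumes "f \<in> free_module n"
  shows "\<exists>b\<noteq>0. \<exists>g\<in>free_module n. vscale [:to_fract b:] f = fract_vec g"
proof -
  obtain b q where b: "\<And>i. b i \<noteq> 0" "\<And>i. smult (to_fract (b i)) (f i) = fract_poly (q i)"
    using clear_denominators_poly[of "f _"] by metis
  \<comment> \<open>The product of all component denominators; component \<open>i\<close> keeps the
    factors other than \<open>b i\<close>.\<close>
  define c where "c = prod b {..<n}"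
  define g where "g = (\<lambda>i. if i < n then smult (prod b ({..<n} - {i})) (q i) else 0)"
  have "smult (to_fract c) (f i) = fract_poly (g i)" for i
  proof (cases "i < n")
    case True
    then have "c = prod b ({..<n} - {i}) * b i"
      unfolding c_def by (subst prod.remove[of _ i]) (auto simp: mult.commute)
    then show ?thesis using True by (simp add: g_def flip: b(2))
  next
    case False
    then show ?thesis using assms by (simp add: g_def free_module_def)
  qed
  then have "vscale [:to_fract c:] f = fract_vec g"
    by (simp add: vscale_def fract_vec_def fun_eq_iff)
  moreover have "c \<noteq> 0" unfolding c_def using b(1) by simp
  moreover have "g \<in> free_module n" by (simp add: g_def free_module_def)
  ultimately show ?thesis by blast
qed

text \<open>A common denominator of the coefficients of a combination turns it into one over the
  integral polynomials. It supplies the multiplier in the saturation.\<close>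

lemma clear_denominators_span:
  fixes f :: "nat \<Rightarrow> 'a::idom fract poly"
  assumes "f \<in> vec.span (fract_vec ` G)"
  shows "\<exists>b\<noteq>0. \<exists>g\<in>vec.span G. vscale [:to_fract b:] f = fract_vec g"
  using assms
proof (induction rule: vec.span_induct_alt)
  case base
  show ?case
    by (intro exI[of _ 1] conjI bexI[of _ 0]) (auto simp: fract_vec_zero vec.span_zero simp del: zero_fun_apply)
next
  case (step c x y)
  obtain x' where x: "x' \<in> G" "x = fract_vec x'" using step by blast
  obtain b g where b: "b \<noteq> 0" "g \<in> vec.span G" "vscale [:to_fract b:] y = fract_vec g"
    using step by blast
  obtain d q where d: "d \<noteq> 0" "smult (to_fract d) c = fract_poly q"
    using clear_denominators_poly by blast
  \<comment> \<open>With \<open>d\<close> clearing the new coefficient \<open>c\<close> and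
    \<open>b\<close> clearing \<open>y\<close>, this is \<open>d * b\<close> times the
    combination.\<close>
  let ?g = "vscale (smult b q) x' + vscale [:d:] g"
  have "?g \<in> vec.span G"
    by (rule vec.span_add[OF vec.span_scale[OF vec.span_base[OF x(1)]] vec.span_scale[OF b(2)]])
  moreover have "vscale [:to_fract (d * b):] (vscale c x + y) = fract_vec ?g"
    by (simp add: fract_vec_add fract_vec_vscale x(2) map_poly_pCons flip: b(3) d(2))
      (simp add: vscale_def fun_eq_iff smult_add_right mult.commute)
  moreover have "d * b \<noteq> 0" using b(1) d(1) by simp
  ultimately show ?case by blast
qed

lemma fract_vec_span:
  assumes "g \<in> vec.span G"
  shows "fract_vec g \<in> vec.span (fract_vec ` G)"
  using assms
  by (induction rule: vec.span_induct_alt)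
    (auto simp: fract_vec_zero fract_vec_add fract_vec_vscale simp del: zero_fun_apply plus_fun_apply
      intro: vec.span_zero vec.span_add vec.span_scale vec.span_base)

section \<open>Comparison of syzygies over the domain and over its fraction field\<close>

text \<open>A syzygy over the field becomes integral after scaling by a nonzero constant, which is
  invertible there. So finite generation carries over to the field.\<close>

lemma span_fract_eq_syzygies:
  fixes u :: "nat \<Rightarrow> nat \<Rightarrow> 'a::idom poly"
  assumes "vec.span G = syzygies vscale n u"
  shows "vec.span (fract_vec ` G) = syzygies vscale n (\<lambda>j. fract_vec (u j))"
    (is "_ = ?K")
proof
  have K: "vec.subspace ?K" by (intro subspace_syzygies) unfold_locales
  have "fract_vec ` G \<subseteq> ?K" using assms vec.span_base fract_vec_syzygies_iff by blast
  then show "vec.span (fract_vec ` G) \<subseteq> ?K" using K by (rule vec.span_minimal)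
  show "?K \<subseteq> vec.span (fract_vec ` G)"
  proof
    fix f assume f: "f \<in> ?K"
    then obtain b g where b: "b \<noteq> 0" "vscale [:to_fract b:] f = fract_vec g"
      using clear_denominators_vec[of f n] unfolding syzygies_def by blast
    then have "fract_vec g \<in> ?K" using vec.subspace_scale[OF K f] by metis
    then have "vscale [:to_fract b:] f \<in> vec.span (fract_vec ` G)"
      using fract_vec_syzygies_iff assms fract_vec_span b(2) by metis
    then have "vscale [:1 / to_fract b:] (vscale [:to_fract b:] f) \<in> vec.span (fract_vec ` G)"
      by (rule vec.span_scale)
    moreover have "vscale [:1 / to_fract b:] (vscale [:to_fract b:] f) = f"
      using b(1) by (simp add: vscale_def)
    ultimately show "f \<in> vec.span (fract_vec ` G)" by simp
  qed
qed

text \<open>Each \<open>s j\<close> is scaled by its own denominator, a unit over the field, so the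
  span does not change.\<close>

lemma integral_generators:
  fixes s :: "nat \<Rightarrow> nat \<Rightarrow> 'a::idom fract poly"
  assumes "\<And>j. j < m \<Longrightarrow> s j \<in> free_module n"
  shows "\<exists>t. (\<forall>j<m. t j \<in> free_module n) \<and>
    vec.span ((\<lambda>j. fract_vec (t j)) ` {..<m}) = vec.span (s ` {..<m})"
proof -
  have "\<forall>j. \<exists>b g. j < m \<longrightarrow> b \<noteq> 0 \<and> g \<in> free_module n \<and> vscale [:to_fract b:] (s j) = fract_vec g"
    using clear_denominators_vec assms by meson
  then obtain b t where t: "\<And>j. j < m \<Longrightarrow> b j \<noteq> 0" "\<And>j. j < m \<Longrightarrow> t j \<in> free_module n"
      "\<And>j. j < m \<Longrightarrow> vscale [:to_fract (b j):] (s j) = fract_vec (t j)"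
    by metis
  have "s j = vscale [:1 / to_fract (b j):] (fract_vec (t j))" if "j < m" for j
    using t(1)[OF that] by (simp add: vscale_def flip: t(3)[OF that])
  then have "s j \<in> vec.span ((\<lambda>j. fract_vec (t j)) ` {..<m})" if "j < m" for j
    using that vec.span_scale vec.span_base by (metis imageI lessThan_iff)
  moreover have "fract_vec (t j) \<in> vec.span (s ` {..<m})" if "j < m" for j
    using that by (auto simp flip: t(3) intro: vec.span_scale vec.span_base)
  ultimately show ?thesis using t(2) by (intro exI[of _ t]) (auto simp: vec.span_eq)
qed

text \<open>Clearing denominators gives one inclusion, saturatedness of the syzygy module the
  other.\<close>

lemma syzygies_eq_saturation:
  fixes u :: "nat \<Rightarrow> nat \<Rightarrow> 'a::idom poly"
  assumes S: "S \<subseteq> free_module n"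
    and span: "vec.span (fract_vec ` S) = syzygies vscale n (\<lambda>j. fract_vec (u j))"
  shows "syzygies vscale n u = saturation const_scale (vec.span S) (free_module n)"
proof
  show "syzygies vscale n u \<subseteq> saturation const_scale (vec.span S) (free_module n)"
  proof
    fix f assume f: "f \<in> syzygies vscale n u"
    then have "fract_vec f \<in> vec.span (fract_vec ` S)" by (simp add: span fract_vec_syzygies_iff)
    then obtain b g where b: "b \<noteq> 0" "g \<in> vec.span S" "vscale [:to_fract b:] (fract_vec f) = fract_vec g"
      using clear_denominators_span by blast
    have "fract_vec (const_scale b f) = fract_vec g"
      by (simp add: const_scale_eq fract_vec_vscale map_poly_pCons b(3))
    then have "const_scale b f \<in> vec.span S" using b(2) by (simp add: fract_vec_eq_iff)
    then show "f \<in> saturation const_scale (vec.span S) (free_module n)"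
      using b(1) f by (auto simp: saturation_def syzygies_def)
  qed
  have "S \<subseteq> syzygies vscale n u" using span vec.span_base fract_vec_syzygies_iff by blast
  moreover have vec: "module (vscale :: 'a poly \<Rightarrow> _)" by unfold_locales
  ultimately have "vec.span S \<subseteq> syzygies vscale n u"
    using subspace_syzygies vec.span_minimal by blast
  then show "saturation const_scale (vec.span S) (free_module n) \<subseteq> syzygies vscale n u"
    using syzygies_saturated[OF vec vscale_torsion_free] by (auto simp: saturation_def)
qed

theorem theorem3p1:
  fixes u :: "nat \<Rightarrow> nat \<Rightarrow> 'v::valuation_domain poly" and n k :: nat
  assumes "\<forall>j<n. u j \<in> free_module k"
  shows
    "(\<forall>m (s :: nat \<Rightarrow> nat \<Rightarrow> 'v fract poly).
        vec.span (s ` {..<m}) = syzygies vscale n (\<lambda>j. fract_vec (u j)) \<longrightarrow>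
        (\<exists>t :: nat \<Rightarrow> nat \<Rightarrow> 'v poly. (\<forall>j<m. t j \<in> free_module n) \<and>
           vec.span ((\<lambda>j. fract_vec (t j)) ` {..<m}) = syzygies vscale n (\<lambda>j. fract_vec (u j)))) \<and>
     (\<exists>m (s :: nat \<Rightarrow> nat \<Rightarrow> 'v poly). (\<forall>j<m. s j \<in> free_module n) \<and>
        vec.span ((\<lambda>j. fract_vec (s j)) ` {..<m}) = syzygies vscale n (\<lambda>j. fract_vec (u j))) \<and>
     (\<forall>m (s :: nat \<Rightarrow> nat \<Rightarrow> 'v poly).
        (\<forall>j<m. s j \<in> free_module n) \<and>
        vec.span ((\<lambda>j. fract_vec (s j)) ` {..<m}) = syzygies vscale n (\<lambda>j. fract_vec (u j)) \<longrightarrow>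
        syzygies vscale n u = saturation const_scale (vec.span (s ` {..<m})) (free_module n)) \<and>
     finitely_generated (syzygies vscale n u) \<and>
     coherent_ring TYPE('v poly)"
proof (intro conjI allI impI)
  let ?K = "syzygies vscale n (\<lambda>j. fract_vec (u j))"
  fix m and s :: "nat \<Rightarrow> nat \<Rightarrow> 'v fract poly"
  assume s: "vec.span (s ` {..<m}) = ?K"
  then have "s j \<in> free_module n" if "j < m" for j
    using that vec.span_base[of "s j" "s ` {..<m}"] by (auto simp: syzygies_def)
  then show "\<exists>t :: nat \<Rightarrow> nat \<Rightarrow> 'v poly. (\<forall>j<m. t j \<in> free_module n) \<and>
      vec.span ((\<lambda>j. fract_vec (t j)) ` {..<m}) = ?K"
    using integral_generators[of m s n] s by simp
next
  let ?K = "syzygies vscale n (\<lambda>j. fract_vec (u j))"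
  fix m and s :: "nat \<Rightarrow> nat \<Rightarrow> 'v poly"
  assume "(\<forall>j<m. s j \<in> free_module n) \<and> vec.span ((\<lambda>j. fract_vec (s j)) ` {..<m}) = ?K"
  then show "syzygies vscale n u = saturation const_scale (vec.span (s ` {..<m})) (free_module n)"
    by (intro syzygies_eq_saturation) (auto simp: image_image)
next
  \<comment> \<open>Finite generation comes before the existence of integral generators over the
    field, because these are obtained from a finite generating set over \<open>V[X]\<close>.\<close>
  show fg: "finitely_generated (syzygies vscale n u)"
    by (rule syzygies_finitely_generated) (unfold_locales, rule vscale_torsion_free)
  then obtain S where S: "finite S" "vec.span S = syzygies vscale n u"
    unfolding finitely_generated_def by blast
  then obtain m s where s: "S = s ` {i::nat. i < m}" using finite_imp_nat_seg_image_inj_on by metis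
  have "\<forall>j<m. s j \<in> free_module n"
    using S(2) vec.span_base[of _ S] by (auto simp: s syzygies_def)
  moreover have "vec.span ((\<lambda>j. fract_vec (s j)) ` {..<m}) = syzygies vscale n (\<lambda>j. fract_vec (u j))"
    using span_fract_eq_syzygies[OF S(2)] by (simp add: s image_image lessThan_def)
  ultimately show "\<exists>m (s :: nat \<Rightarrow> nat \<Rightarrow> 'v poly). (\<forall>j<m. s j \<in> free_module n) \<and>
      vec.span ((\<lambda>j. fract_vec (s j)) ` {..<m}) = syzygies vscale n (\<lambda>j. fract_vec (u j))"
    by blast
next
  show "coherent_ring TYPE('v poly)"
    unfolding coherent_ring_def by (intro allI syzygies_finitely_generated module_mult) simp
qed

end
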